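(* Consider the cyclic manufacturing system (without transportation delay) of $N$ production processes with homogeneous production control gain $h^i=h\in(0,1)$ for all $i$, described in the context. Let $\gamma_m=\frac{1}{2(1-h)}$. Suppose that, for every route $i\to j$ (i.e. $j=i+1$ for $1\le i\le N-1$, and $j=1$ for $i=N$), the transportation controller $\mathcal{C}_\tau^{i\to j}$ is designed such that: (i) $\mathcal{C}_\tau^{i\to j}$ is a single-input single-output memoryless map with input $y_c^{i\to j}(t)\in\mathbb{R}$ and output $u_c^{i\to j}(t)\in[-1,1]$; (ii) the cascade connection of $\mathcal{C}_\tau^{i\to j}$ and the stochastic actuator $\mathcal{T}^{i\to j}$, a memoryless stochastic map with input $y_c^{i\to j}(t)$ and output $u_a^{i\to j}(t)$, satisfies $E[u_a^{i\to j}(t)\,y_c^{i\to j}(t)]\ge\delta\,E[(u_a^{i\to j}(t))^2]$ (for every value of the input $y_c^{i\to j}(t)$), where $\delta\ge2\gamma_m$. Then for every $t$ the overall system satisfies $$E\big[V(x(t+1))\,\big|\,x(t)\big]-V(x(t))\le0,\qquad V(x(t))=0.5\,x^T(t)x(t).$$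
   Context: System. The state is $x=[x^{1T},\dots,x^{NT}]^T\in\mathbb{R}^{2N}$ with $x^i=[x_I^i,\ x_O^i]^T$ (stock levels of the input and output buffers of process $i$). The dynamics is $$x(t+1)=Ax(t)+Bu_a(t),\qquad A=\mathrm{diag}\{A^1,\dots,A^N\},\quad A^i=\begin{bmatrix} 1-h & h \\ h & 1-h \end{bmatrix},$$ where $u_a(t)=[u_a^{1\to2}(t),u_a^{2\to3}(t),\dots,u_a^{N\to1}(t)]^T\in\mathbb{R}^N$ and $B\in\mathbb{R}^{2N\times N}$ is the incidence matrix: the column of route $i\to j$ has entry $-1$ in the row of $x_O^i$, entry $+1$ in the row of $x_I^j$, and $0$ elsewhere. (Thus materials leave the output buffer of $i$ and enter the input buffer of $j$.) Feedback. The controller inputs are the components of $y_c(t)=-B^Tx(t)$, i.e. $y_c^{i\to j}(t)=x_O^i(t)-x_I^j(t)$; then $u_c^{i\to j}(t)=\mathcal{C}_\tau^{i\to j}(y_c^{i\to j}(t))$ (a deterministic function) and $u_a^{i\to j}(t)=\mathcal{T}^{i\to j}(u_c^{i\to j}(t))$. Stochastic actuator. For input $u_c\in[-1,1]$, $\mathcal{T}^{i\to j}(u_c)$ is a random variable with values in $\{+1,0,-1\}$: it equals $+1$ with probability $\max(u_c,0)$, $-1$ with probability $\max(-u_c,0)$, and $0$ with probability $1-|u_c|$. Expectations in (ii) are over this randomness for the given value of $y_c^{i\to j}(t)$; conditionally on $x(t)$, each $u_a^{i\to j}(t)$ equals $+1$ with probability $\max(u_c^{i\to j}(t),0)$, $-1$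 with probability $\max(-u_c^{i\to j}(t),0)$, and $0$ with probability $1-|u_c^{i\to j}(t)|$. *)

theory Defs
  imports "HOL-Probability.Probability" "Jordan_Normal_Form.Matrix"
begin

text \<open>
  Vectors and matrices are those of \<^theory>\<open>Jordan_Normal_Form.Matrix\<close>, since the number
  \<open>N\<close> of processes enters the structure of \<open>A\<close> and \<open>B\<close>. The symbols that this theory
  shares with the analysis library are reserved for its vectors.
\<close>

no_notation vec_nth (infixl \<open>$\<close> 90)
no_notation inner (infix \<open>\<bullet>\<close> 70)


text \<open>
  Processes are numbered \<open>0, \<dots>, N - 1\<close>. The input buffer of process \<open>i\<close> is coordinate
  \<open>2 * i\<close> of the state and its output buffer is coordinate \<open>2 * i + 1\<close>. Route \<open>i\<close> leads from
  process \<open>i\<close> to process \<open>(i + 1) mod N\<close>.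
\<close>

definition process_mat :: "real \<Rightarrow> real mat" where
  "process_mat h = mat_of_rows_list 2 [[1 - h, h], [h, 1 - h]]"

definition system_mat :: "nat \<Rightarrow> real \<Rightarrow> real mat" where
  "system_mat N h = diag_block_mat (replicate N (process_mat h))"

definition incidence_mat :: "nat \<Rightarrow> real mat" where
  "incidence_mat N = mat (2 * N) N (\<lambda>(r, i).
     if r = 2 * i + 1 then - 1 else if r = 2 * ((i + 1) mod N) then 1 else 0)"

definition controller_input :: "nat \<Rightarrow> real vec \<Rightarrow> real vec" where
  "controller_input N x = - ((incidence_mat N)\<^sup>T *\<^sub>v x)"

definition storage :: "real vec \<Rightarrow> real" where
  "storage x = 1 / 2 * (x \<bullet> x)"

definition gamma_m :: "real \<Rightarrow> real" where
  "gamma_m h = 1 / (2 * (1 - h))"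


text \<open>
  The weights below form a probability mass function exactly for inputs in \<open>{-1..1}\<close>;
  outside this range the distribution is unspecified.
\<close>

definition actuator :: "real \<Rightarrow> real pmf" where
  "actuator u = embed_pmf (\<lambda>v. if v = 1 then max u 0 else if v = - 1 then max (- u) 0
                               else if v = 0 then 1 - \<bar>u\<bar> else 0)"

lemma pmf_actuator:
  assumes "u \<in> {-1..1}"
  shows "pmf (actuator u) v = (if v = 1 then max u 0 else if v = - 1 then max (- u) 0
                               else if v = 0 then 1 - \<bar>u\<bar> else 0)"
  unfolding actuator_def
proof (rule pmf_embed_pmf)
  let ?f = "\<lambda>v::real. if v = 1 then max u 0 else if v = - 1 then max (- u) 0
                      else if v = 0 then 1 - \<bar>u\<bar> else 0"
  show nonneg: "0 \<le> ?f v" for v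
    using assms by auto
  have "(\<integral>\<^sup>+ v. ennreal (?f v) \<partial>count_space UNIV) =
        (\<Sum>v\<in>{1, -1, 0}. ennreal (?f v))"
    by (rule nn_integral_count_space'[where A = "{1, -1, 0}"]) auto
  also have "\<dots> = ennreal (\<Sum>v\<in>{1, -1, 0}. ?f v)"
    by (rule sum_ennreal) (use nonneg in blast)
  also have "(\<Sum>v\<in>{1, -1, 0}. ?f v) = 1"
    by (auto simp: max_def)
  finally show "(\<integral>\<^sup>+ v. ennreal (?f v) \<partial>count_space UNIV) = 1"
    by simp
qed


text \<open>The Borel sigma-algebra on real vectors of dimension \<open>n\<close>, transported from the
  product space of the coordinates.\<close>

definition vec_borel :: "nat \<Rightarrow> real vec measure" where
  "vec_borel n = vimage_algebra (carrier_vec n) (\<lambda>v. \<lambda>i\<in>{..<n}. v $ i)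
                   (\<Pi>\<^sub>M i\<in>{..<n}. borel)"

text \<open>
  The sub-sigma-algebra generated by a random vector \<open>X\<close> of dimension \<open>n\<close>. Conditional
  expectation given \<open>X\<close> is conditional expectation with respect to it. As \<^const>\<open>storage\<close> is
  nonnegative, its conditional expectation is taken with \<^const>\<open>nn_cond_exp\<close>, which exists
  without any integrability condition on the initial state; \<^const>\<open>real_cond_exp\<close> would
  silently replace an infinite value by \<open>0\<close>.
\<close>

definition generated_by :: "'w measure \<Rightarrow> nat \<Rightarrow> ('w \<Rightarrow> real vec) \<Rightarrow> 'w measure" where
  "generated_by M n X = vimage_algebra (space M) X (vec_borel n)"


text \<open>
  A run of the closed loop on a probability space. Each controller \<open>C i\<close> is a fixed function
  of the current input only. The law of the actuator outputs is prescribed route by route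
  conditionally on the current state; their joint conditional law is left open, and so is the
  law of the initial state.
\<close>

locale cyclic_manufacturing_system = prob_space M
  for M :: "'w measure" +
  fixes N :: nat
    and h :: real
    and C :: "nat \<Rightarrow> real \<Rightarrow> real"
    and x :: "nat \<Rightarrow> 'w \<Rightarrow> real vec"
    and u_a :: "nat \<Rightarrow> 'w \<Rightarrow> real vec"
  assumes state_rv: "\<And>t. random_variable (vec_borel (2 * N)) (x t)"
    and actuation_rv: "\<And>t. random_variable (vec_borel N) (u_a t)"
    and dynamics: "\<And>t \<omega>. \<omega> \<in> space M \<Longrightarrow>
      x (t + 1) \<omega> = system_mat N h *\<^sub>v x t \<omega> + incidence_mat N *\<^sub>v u_a t \<omega>"
    and actuation_law: "\<And>t i v. i < N \<Longrightarrow> v \<in> {1, 0, -1} \<Longrightarrow>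
      AE \<omega> in M. real_cond_exp M (generated_by M (2 * N) (x t))
                    (indicator {\<omega> \<in> space M. u_a t \<omega> $ i = v}) \<omega>
                  = pmf (actuator (C i (controller_input N (x t \<omega>) $ i))) v"

end

theory Submission
  imports Defs
begin

text \<open>
  Write \<open>a i\<close> and \<open>b i\<close> for the input and output buffer levels of process \<open>i\<close> and
  \<open>d i = a i - b i\<close>. The production step lowers twice the storage by \<open>2 * h * (1 - h) * (d i)\<^sup>2\<close>
  for each process, while the transport contributes \<open>2 * (u i)\<^sup>2 - 2 * u i * y i\<close> and a cross term
  \<open>- 2 * h * u i * d k\<close> for each of the two processes \<open>k\<close> that route \<open>i\<close> connects. Completing
  squares in the \<open>d k\<close> uses up exactly the production decrease and leaves a
  storage increment of at most \<open>(u i)\<^sup>2 / (1 - h) - u i * y i\<close> per route, where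
  \<open>1 / (1 - h) = 2 * gamma_m h\<close>. Given the state, the expectation of this bound is nonpositive by
  the hypothesis on the cascade of controller and actuator.
\<close>

section \<open>Coordinates of the closed loop\<close>

lemma process_mat_carrier: "process_mat h \<in> carrier_mat 2 2"
  unfolding process_mat_def mat_of_rows_list_def by (rule carrier_matI) simp_all

lemma system_mat_Suc:
  "system_mat (Suc N) h = (let D = system_mat N h in
    four_block_mat (process_mat h) (0\<^sub>m 2 (dim_col D)) (0\<^sub>m (dim_row D) 2) D)"
  using process_mat_carrier[of h] unfolding system_mat_def by (simp add: Let_def)

lemma system_mat_carrier: "system_mat N h \<in> carrier_mat (2 * N) (2 * N)"
proof (induction N)
  case 0
  show ?case
    by (simp add: system_mat_def)
next
  case (Suc N)
  have "system_mat (Suc N) h \<in> carrier_mat (2 + 2 * N) (2 + 2 * N)"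
    unfolding system_mat_Suc Let_def
    by (rule four_block_carrier_mat[OF process_mat_carrier Suc.IH])
  then show ?case
    by simp
qed

lemma system_mat_index:
  "i < 2 * N \<Longrightarrow> j < 2 * N \<Longrightarrow>
    system_mat N h $$ (i, j) = (if i div 2 = j div 2 then (if i = j then 1 - h else h) else 0)"
proof (induction N arbitrary: i j)
  case (Suc N)
  let ?P = "process_mat h" and ?D = "system_mat N h"
  have P: "dim_row ?P = 2" "dim_col ?P = 2"
    using process_mat_carrier[of h] by auto
  have D: "dim_row ?D = 2 * N" "dim_col ?D = 2 * N"
    using system_mat_carrier[of N h] by auto
  have eq: "system_mat (Suc N) h
      = four_block_mat ?P (0\<^sub>m 2 (2 * N)) (0\<^sub>m (2 * N) 2) ?D"
    by (simp add: system_mat_Suc Let_def D)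
  have Pi: "?P $$ (i, j) = (if i = j then 1 - h else h)" if "i < 2" "j < 2"
    using that by (auto simp: process_mat_def mat_of_rows_list_def less_2_cases_iff)
  consider "i < 2" "j < 2" | "i < 2" "j \<ge> 2" | "i \<ge> 2" "j < 2" | "i \<ge> 2" "j \<ge> 2"
    by linarith
  then show ?case
  proof cases
    \<comment> \<open>In the lower right block, dropping the first process shifts both indices by 2,
      which preserves equality of indices and of their \<open>div 2\<close>.\<close>
    case 4
    then obtain i' j' where "i = i' + 2" "j = j' + 2"
      by (metis add.commute le_iff_add)
    then show ?thesis
      using Suc.prems Suc.IH[of i' j'] by (simp add: eq P D)
  qed (use Suc.prems in \<open>auto simp: eq P D Pi\<close>)
qed auto

lemma sum_lessThan_double:
  fixes f :: "nat \<Rightarrow> 'a :: comm_monoid_add"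
  shows "sum f {..<2 * N} = (\<Sum>i<N. f (2 * i) + f (2 * i + 1))"
  by (induction N) (auto simp: add.assoc)

lemma index_system_mat_mult:
  fixes x :: "real vec"
  assumes "x \<in> carrier_vec (2 * N)" "i < N"
  shows "(system_mat N h *\<^sub>v x) $ (2 * i) = (1 - h) * x $ (2 * i) + h * x $ (2 * i + 1)"
    and "(system_mat N h *\<^sub>v x) $ (2 * i + 1) = h * x $ (2 * i) + (1 - h) * x $ (2 * i + 1)"
proof -
  have d: "dim_row (system_mat N h) = 2 * N" "dim_col (system_mat N h) = 2 * N"
    using system_mat_carrier[of N h] by auto
  have *: "(system_mat N h *\<^sub>v x) $ r = (\<Sum>k<N. system_mat N h $$ (r, 2 * k) * x $ (2 * k)
      + system_mat N h $$ (r, 2 * k + 1) * x $ (2 * k + 1))" if "r < 2 * N" for r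
    using that assms d
    by (simp add: scalar_prod_def atLeast0LessThan sum_lessThan_double)
  have odd: "2 * a \<noteq> Suc (2 * b)" "Suc (2 * b) \<noteq> 2 * a" for a b :: nat
    by presburger+
  have "(system_mat N h *\<^sub>v x) $ (2 * i)
      = (\<Sum>k<N. if k = i then (1 - h) * x $ (2 * i) + h * x $ (2 * i + 1) else 0)"
    using assms(2) odd by (subst *, simp, intro sum.cong) (auto simp: system_mat_index)
  then show "(system_mat N h *\<^sub>v x) $ (2 * i) = (1 - h) * x $ (2 * i) + h * x $ (2 * i + 1)"
    using assms by (simp add: sum.delta)
  have "(system_mat N h *\<^sub>v x) $ (2 * i + 1)
      = (\<Sum>k<N. if k = i then h * x $ (2 * i) + (1 - h) * x $ (2 * i + 1) else 0)"
    using assms(2) odd by (subst *, simp, intro sum.cong) (auto simp: system_mat_index)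
  then show "(system_mat N h *\<^sub>v x) $ (2 * i + 1) = h * x $ (2 * i) + (1 - h) * x $ (2 * i + 1)"
    using assms by (simp add: sum.delta)
qed

text \<open>An injective self-map of a finite set is onto. This is what allows sums over processes
  to be rewritten as sums over the destinations of routes.\<close>

lemma bij_betw_succ_mod:
  fixes N :: nat
  shows "bij_betw (\<lambda>i. (i + 1) mod N) {..<N} {..<N}"
proof -
  have "inj_on (\<lambda>i. (i + 1) mod N) {..<N}"
  proof (rule inj_onI)
    fix i j assume "i \<in> {..<N}" "j \<in> {..<N}" "(i + 1) mod N = (j + 1) mod N"
    then show "i = j"
      by (simp add: mod_Suc split: if_splits)
  qed
  moreover have "(\<lambda>i. (i + 1) mod N) ` {..<N} \<subseteq> {..<N}"
    by (cases N) auto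
  ultimately show ?thesis
    by (simp add: bij_betw_def endo_inj_surj)
qed

text \<open>On the cycle each output buffer feeds exactly one route and each input buffer is fed by
  exactly one, so every row of the incidence matrix has a single nonzero entry.\<close>

lemma index_incidence_mat_mult:
  fixes u :: "real vec"
  assumes "u \<in> carrier_vec N" "i < N"
  shows "(incidence_mat N *\<^sub>v u) $ (2 * ((i + 1) mod N)) = u $ i"
    and "(incidence_mat N *\<^sub>v u) $ (2 * i + 1) = - u $ i"
proof -
  have d: "dim_row (incidence_mat N) = 2 * N" "dim_col (incidence_mat N) = N"
    by (auto simp: incidence_mat_def)
  have *: "(incidence_mat N *\<^sub>v u) $ r = (\<Sum>k<N. incidence_mat N $$ (r, k) * u $ k)"
    if "r < 2 * N" for r
    using that assms d by (simp add: scalar_prod_def atLeast0LessThan)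
  have lt: "2 * ((i + 1) mod N) < 2 * N" "2 * i + 1 < 2 * N"
    using assms by auto
  have odd: "2 * a \<noteq> Suc (2 * b)" for a b :: nat
    by presburger
  have inj: "(i + 1) mod N = (k + 1) mod N \<longleftrightarrow> i = k" if "k < N" for k
    using bij_betw_imp_inj_on[OF bij_betw_succ_mod[of N]] that assms(2)
    by (auto dest: inj_onD)
  have "(incidence_mat N *\<^sub>v u) $ (2 * ((i + 1) mod N)) = (\<Sum>k<N. if k = i then u $ i else 0)"
    unfolding *[OF lt(1)] using lt inj odd
    by (intro sum.cong) (auto simp: incidence_mat_def)
  then show "(incidence_mat N *\<^sub>v u) $ (2 * ((i + 1) mod N)) = u $ i"
    using assms by (simp add: sum.delta)
  have "(incidence_mat N *\<^sub>v u) $ (2 * i + 1) = (\<Sum>k<N. if k = i then - u $ i else 0)"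
    unfolding *[OF lt(2)] using lt odd[symmetric]
    by (intro sum.cong) (auto simp: incidence_mat_def)
  then show "(incidence_mat N *\<^sub>v u) $ (2 * i + 1) = - u $ i"
    using assms by (simp add: sum.delta)
qed

lemma index_controller_input:
  assumes "x \<in> carrier_vec (2 * N)" "i < N"
  shows "controller_input N x $ i = x $ (2 * i + 1) - x $ (2 * ((i + 1) mod N))"
proof -
  let ?s = "\<lambda>i. (i + 1) mod N"
  have s: "?s i < N"
    using assms by auto
  have odd: "2 * a \<noteq> Suc (2 * b)" "Suc (2 * b) \<noteq> 2 * a" for a b :: nat
    by presburger+
  have "controller_input N x $ i = - (\<Sum>r<2 * N. incidence_mat N $$ (r, i) * x $ r)"
    using assms
    by (auto simp: controller_input_def scalar_prod_def incidence_mat_def atLeast0LessThan)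
  \<comment> \<open>Column \<open>i\<close> meets the even rows only at the input buffer of the
    destination, and the odd rows only at the output buffer of the source.\<close>
  also have "\<dots> = - (\<Sum>k<N. (if k = ?s i then x $ (2 * ?s i) else 0)
      + (if k = i then - x $ (2 * i + 1) else 0))"
    unfolding sum_lessThan_double using assms(2) odd
    by (intro arg_cong[where f = uminus] sum.cong) (auto simp: incidence_mat_def)
  also have "\<dots> = x $ (2 * i + 1) - x $ (2 * ?s i)"
    using assms s by (simp add: sum.distrib sum.delta)
  finally show ?thesis .
qed

section \<open>Storage increment along one step\<close>

lemma storage_eq:
  assumes "x \<in> carrier_vec (2 * N)"
  shows "2 * storage x = (\<Sum>i<N. (x $ (2 * i))\<^sup>2 + (x $ (2 * i + 1))\<^sup>2)"
  using assms
  by (simp add: storage_def scalar_prod_def atLeast0LessThan sum_lessThan_double power2_eq_square)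

lemma storage_nonneg: "0 \<le> storage x"
  by (auto simp: storage_def scalar_prod_def intro!: sum_nonneg)

text \<open>This bound is deterministic and separates over the routes, so that taking conditional
  expectations later involves each actuator only through its own law.\<close>

lemma storage_step_le:
  fixes x u :: "real vec"
  assumes h: "0 < h" "h < 1" and x: "x \<in> carrier_vec (2 * N)" and u: "u \<in> carrier_vec N"
    and \<delta>: "2 * gamma_m h \<le> \<delta>"
  shows "storage (system_mat N h *\<^sub>v x + incidence_mat N *\<^sub>v u)
    \<le> storage x + (\<Sum>i<N. \<delta> * (u $ i)\<^sup>2 - u $ i * controller_input N x $ i)"
proof -
  let ?s = "\<lambda>i. (i + 1) mod N"
  define z where "z = system_mat N h *\<^sub>v x + incidence_mat N *\<^sub>v u"
  define a where "a i = x $ (2 * i)" for i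
  define b where "b i = x $ (2 * i + 1)" for i
  define d where "d i = a i - b i" for i
  \<comment> \<open>A route leads from an output buffer to the input buffer of the next process. The squares are
    therefore completed with separate reserves \<open>S\<close> (input side) and \<open>T\<close> (output side), which
    cancel process by process.\<close>
  define S where "S i = h\<^sup>2 * (d i)\<^sup>2 - 2 * h * a i * d i + h * (1 - h) * (d i)\<^sup>2" for i
  define T where "T i = h\<^sup>2 * (d i)\<^sup>2 + 2 * h * b i * d i + h * (1 - h) * (d i)\<^sup>2" for i
  have reindex: "(\<Sum>i<N. f (?s i)) = (\<Sum>i<N. f i)" for f :: "nat \<Rightarrow> real"
    using sum.reindex_bij_betw[OF bij_betw_succ_mod] .
  have [simp]: "dim_row (incidence_mat N) = 2 * N" "dim_row (system_mat N h) = 2 * N"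
    using system_mat_carrier[of N h] by (auto simp: incidence_mat_def)
  have z: "z \<in> carrier_vec (2 * N)"
    unfolding z_def by (rule carrier_vecI) simp
  have index_z: "z $ r = (system_mat N h *\<^sub>v x) $ r + (incidence_mat N *\<^sub>v u) $ r"
    if "r < 2 * N" for r
    unfolding z_def using that by (subst index_add_vec(1)) simp_all
  have z_in: "z $ (2 * ?s i) = a (?s i) - h * d (?s i) + u $ i" if "i < N" for i
  proof -
    have "?s i < N" using that by auto
    from index_system_mat_mult(1)[OF x this, of h] this show ?thesis
      unfolding a_def b_def d_def
      by (subst index_z) (simp_all only: index_incidence_mat_mult(1)[OF u that], simp_all add: algebra_simps)
  qed
  have z_out: "z $ (2 * i + 1) = b i + h * d i - u $ i" if "i < N" for i
    using that index_system_mat_mult(2)[OF x that, of h] unfolding a_def b_def d_def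
    by (subst index_z) (simp_all only: index_incidence_mat_mult(2)[OF u that], simp_all add: algebra_simps)
  \<comment> \<open>The weights are chosen so that \<open>e\<^sup>2\<close> gets the coefficient
    \<open>h * (1 - h)\<close>. This is half of what production gains at a process: one half pays
    for the incoming route, the other for the outgoing one.\<close>
  have square: "- (2 * h * v * e) \<le> h * (1 - h) * e\<^sup>2 + h * v\<^sup>2 / (1 - h)" for v e
  proof -
    define g where "g = 1 - h"
    have g: "0 < g"
      using h by (simp add: g_def)
    then have "0 \<le> h / g * (g * e + v)\<^sup>2"
      using h by simp
    also have "\<dots> = h * g * e\<^sup>2 + h * v\<^sup>2 / g + 2 * h * v * e"
      using g by (simp add: power2_eq_square algebra_simps)
    finally show ?thesis by (simp add: g_def)
  qed
  have \<delta>': "1 / (1 - h) \<le> \<delta>"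
    using \<delta> h by (simp add: gamma_m_def field_simps)
  have route: "(z $ (2 * ?s i))\<^sup>2 + (z $ (2 * i + 1))\<^sup>2 - (a (?s i))\<^sup>2 - (b i)\<^sup>2
      \<le> S (?s i) + T i + 2 * (\<delta> * (u $ i)\<^sup>2 - u $ i * controller_input N x $ i)" if "i < N" for i
  proof -
    have y: "controller_input N x $ i = b i - a (?s i)"
      using index_controller_input[OF x that] by (simp add: a_def b_def)
    define A where "A k = h * (1 - h) * (d k)\<^sup>2" for k
    define Q where "Q = h * (u $ i)\<^sup>2 / (1 - h)"
    define X where "X k = 2 * h * u $ i * d k" for k
    have X: "- X k \<le> A k + Q" for k
      unfolding X_def A_def Q_def by (rule square)
    \<comment> \<open>Each end of the route contributes \<open>(u $ i)\<^sup>2\<close> from its own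
      square and \<open>Q\<close> from the completed square. Their sum is
      \<open>(u $ i)\<^sup>2 / (1 - h)\<close>, which is where the threshold
      \<open>2 * gamma_m h\<close> comes from.\<close>
    have "1 + h / (1 - h) = 1 / (1 - h)"
      using h by (simp add: field_simps)
    from arg_cong[OF this, of "\<lambda>r. r * (u $ i)\<^sup>2"]
    have "(u $ i)\<^sup>2 + Q = 1 / (1 - h) * (u $ i)\<^sup>2"
      by (simp add: Q_def algebra_simps)
    also have "\<dots> \<le> \<delta> * (u $ i)\<^sup>2"
      by (intro mult_right_mono[OF \<delta>']) simp
    finally have Q: "(u $ i)\<^sup>2 + Q \<le> \<delta> * (u $ i)\<^sup>2" .
    have "(z $ (2 * ?s i))\<^sup>2 + (z $ (2 * i + 1))\<^sup>2 - (a (?s i))\<^sup>2 - (b i)\<^sup>2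
        = S (?s i) - A (?s i) + (T i - A i)
          - 2 * (u $ i * controller_input N x $ i) + 2 * (u $ i)\<^sup>2 - X (?s i) - X i"
      unfolding z_in[OF that] z_out[OF that] y S_def T_def A_def X_def power2_eq_square
      by (simp only: algebra_simps)
    with Q X[of "?s i"] X[of i] show ?thesis
      unfolding right_diff_distrib by linarith
  qed
  \<comment> \<open>Production alone changes the two squared levels of a process by
    \<open>- 2 * h * (1 - h) * (d i)\<^sup>2\<close> in total, exactly offsetting the terms
    \<open>h * (1 - h) * (d i)\<^sup>2\<close> added in \<open>S\<close> and in
    \<open>T\<close>.\<close>
  have ST: "S i + T i = 0" for i
    by (simp add: S_def T_def d_def power2_eq_square algebra_simps)
  have "2 * storage z - 2 * storage x
      = (\<Sum>i<N. (z $ (2 * i))\<^sup>2) - (\<Sum>i<N. (a i)\<^sup>2) + (\<Sum>i<N. (z $ (2 * i + 1))\<^sup>2 - (b i)\<^sup>2)"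
    by (simp add: storage_eq[OF z] storage_eq[OF x] a_def b_def sum.distrib sum_subtractf)
  \<comment> \<open>The buffers are regrouped by route: an output buffer is paired with the input
    buffer that it supplies.\<close>
  also have "\<dots> = (\<Sum>i<N. (z $ (2 * ?s i))\<^sup>2 + (z $ (2 * i + 1))\<^sup>2 - (a (?s i))\<^sup>2 - (b i)\<^sup>2)"
    using reindex[of "\<lambda>i. (z $ (2 * i))\<^sup>2"] reindex[of "\<lambda>i. (a i)\<^sup>2"]
    by (simp add: sum.distrib sum_subtractf)
  also have "\<dots> \<le> (\<Sum>i<N. S (?s i) + T i + 2 * (\<delta> * (u $ i)\<^sup>2 - u $ i * controller_input N x $ i))"
    by (intro sum_mono route) simp
  also have "\<dots> = (\<Sum>i<N. S i + T i) + 2 * (\<Sum>i<N. \<delta> * (u $ i)\<^sup>2 - u $ i * controller_input N x $ i)"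
    using reindex[of S] by (simp only: sum.distrib sum_distrib_left)
  finally show ?thesis
    by (simp add: ST z_def)
qed

section \<open>Measurability and the sigma-algebra of the state\<close>

lemma coordinate_measurable [measurable]:
  assumes "i < n"
  shows "(\<lambda>v. v $ i) \<in> borel_measurable (vec_borel n)"
proof -
  let ?f = "\<lambda>v. \<lambda>i\<in>{..<n}. v $ i :: real"
  have "?f \<in> carrier_vec n \<rightarrow> space (\<Pi>\<^sub>M i\<in>{..<n}. borel)"
    by (auto simp: space_PiM)
  then have f: "?f \<in> vec_borel n \<rightarrow>\<^sub>M (\<Pi>\<^sub>M i\<in>{..<n}. borel)"
    unfolding vec_borel_def by (rule measurable_vimage_algebra1)
  have "(\<lambda>w. w i) \<in> borel_measurable (\<Pi>\<^sub>M i\<in>{..<n}. borel :: real measure)"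
    using assms by (intro measurable_component_singleton) simp
  from measurable_compose[OF f this] show ?thesis
    using assms by simp
qed

lemma space_vec_borel [simp]: "space (vec_borel n) = carrier_vec n"
  by (simp add: vec_borel_def)

lemma storage_measurable [measurable]: "storage \<in> borel_measurable (vec_borel n)"
proof -
  have "(\<lambda>v. 1 / 2 * (\<Sum>i<n. v $ i * v $ i :: real)) \<in> borel_measurable (vec_borel n)"
    by measurable
  then show ?thesis
    by (rule measurable_cong[THEN iffD1, rotated])
      (auto simp: storage_def scalar_prod_def atLeast0LessThan)
qed

lemma measurable_generated_by:
  assumes "X \<in> M \<rightarrow>\<^sub>M vec_borel n"
  shows "X \<in> generated_by M n X \<rightarrow>\<^sub>M vec_borel n"
  unfolding generated_by_def
  using measurable_space[OF assms] by (intro measurable_vimage_algebra1) auto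

lemma subalgebra_generated_by:
  assumes "X \<in> M \<rightarrow>\<^sub>M vec_borel n"
  shows "subalgebra M (generated_by M n X)"
proof -
  have "X \<in> space M \<rightarrow> space (vec_borel n)"
    using measurable_space[OF assms] by blast
  then have "sets (generated_by M n X) \<subseteq> sets M"
    unfolding generated_by_def using measurable_sets[OF assms]
    by (subst sets_vimage_algebra2) auto
  then show ?thesis
    by (simp add: subalgebra_def generated_by_def)
qed

section \<open>Conditional expectation without integrability\<close>

context sigma_finite_subalgebra
begin

lemma nn_cond_exp_finite_sum:
  assumes "\<And>k. k \<in> I \<Longrightarrow> f k \<in> borel_measurable M"
  shows "AE \<omega> in M. nn_cond_exp M F (\<lambda>\<omega>. \<Sum>k\<in>I. f k \<omega>) \<omega> = (\<Sum>k\<in>I. nn_cond_exp M F (f k) \<omega>)"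
  using assms
proof (induction I rule: infinite_finite_induct)
  case (insert k I)
  have "AE \<omega> in M. nn_cond_exp M F (f k) \<omega> + nn_cond_exp M F (\<lambda>\<omega>. \<Sum>k\<in>I. f k \<omega>) \<omega>
      = nn_cond_exp M F (\<lambda>\<omega>. f k \<omega> + (\<Sum>k\<in>I. f k \<omega>)) \<omega>"
    using insert.prems by (intro nn_cond_exp_sum borel_measurable_sum) auto
  moreover have "AE \<omega> in M. nn_cond_exp M F (\<lambda>\<omega>. \<Sum>k\<in>I. f k \<omega>) \<omega> = (\<Sum>k\<in>I. nn_cond_exp M F (f k) \<omega>)"
    using insert by auto
  ultimately show ?case
    by eventually_elim (use insert.hyps in auto)
\<comment> \<open>An infinite index set, whose sums are 0 by convention, and the empty one remain;
  both reduce to the conditional expectation of 0.\<close>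
qed (use nn_cond_exp_F_meas[of "\<lambda>_. 0"] in \<open>auto elim: AE_mp\<close>)

text \<open>\<open>real_cond_exp\<close> subtracts the conditional expectations of the negative and
  positive parts after turning infinite values into 0. Here the negative part vanishes and the
  positive part is at most 1 almost everywhere, so nothing is lost. This links the actuation law to
  the nonnegative setting.\<close>

lemma nn_cond_exp_indicator:
  assumes E: "E \<in> sets M"
  shows "AE \<omega> in M. nn_cond_exp M F (\<lambda>\<omega>. ennreal (indicator E \<omega>)) \<omega>
    = ennreal (real_cond_exp M F (indicator E) \<omega>)"
proof -
  have neg: "(\<lambda>\<omega>. ennreal (- indicator E \<omega>)) = (\<lambda>_. 0)"
    by (auto simp: indicator_def ennreal_neg)
  have "AE \<omega> in M. nn_cond_exp M F (\<lambda>\<omega>. ennreal (indicator E \<omega>)) \<omega> \<le> nn_cond_exp M F (\<lambda>_. 1) \<omega>"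
    using borel_measurable_indicator[OF E, where ?'b = real]
    by (intro nn_cond_exp_mono AE_I2) (simp_all add: indicator_le_1)
  moreover have "AE \<omega> in M. 1 = nn_cond_exp M F (\<lambda>_. 1) \<omega>"
    by (intro nn_cond_exp_F_meas) simp
  moreover have "AE \<omega> in M. 0 = nn_cond_exp M F (\<lambda>\<omega>. ennreal (- indicator E \<omega>)) \<omega>"
    unfolding neg by (intro nn_cond_exp_F_meas) simp
  ultimately show ?thesis
  proof eventually_elim
    case (elim \<omega>)
    then have "nn_cond_exp M F (\<lambda>\<omega>. ennreal (indicator E \<omega>)) \<omega> < \<top>"
      using ennreal_one_less_top by (metis order_le_less_trans)
    then show ?case
      using elim by (simp add: real_cond_exp_def flip: elim(3))
  qed
qed

text \<open>
  The function \<open>f\<close> need not be integrable, nor need \<open>V\<close> and the coefficients \<open>c k\<close>, so real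
  conditional expectations are of no use here. Instead, the negative parts of the coefficients
  are moved to the side of \<open>f\<close>; every quantity is then nonnegative, and the conditional
  expectations of the added terms are finite and can be cancelled.
\<close>

lemma nn_cond_exp_le_indicator_sum:
  assumes fin: "finite I"
    and E: "\<And>k. k \<in> I \<Longrightarrow> E k \<in> sets M"
    and c: "\<And>k. k \<in> I \<Longrightarrow> c k \<in> borel_measurable F"
    and f: "f \<in> borel_measurable M" "\<And>\<omega>. 0 \<le> f \<omega>"
    and V: "V \<in> borel_measurable F" "\<And>\<omega>. 0 \<le> V \<omega>"
    and le: "AE \<omega> in M. f \<omega> \<le> V \<omega> + (\<Sum>k\<in>I. c k \<omega> * indicator (E k) \<omega>)"
  shows "AE \<omega> in M. nn_cond_exp M F (\<lambda>\<omega>. ennreal (f \<omega>)) \<omega>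
    \<le> ennreal (V \<omega> + (\<Sum>k\<in>I. c k \<omega> * real_cond_exp M F (indicator (E k)) \<omega>))"
proof -
  let ?I = "\<lambda>k \<omega>. ennreal (indicator (E k) \<omega>)"
  let ?p = "\<lambda>k. real_cond_exp M F (indicator (E k))"
  note [measurable] = f(1) V(1)
  have [measurable]: "V \<in> borel_measurable M"
    by (rule measurable_from_subalg[OF subalg V(1)])
  have I_meas: "?I k \<in> borel_measurable M" if "k \<in> I" for k
    using E[OF that] by measurable
  have summand: "AE \<omega> in M. nn_cond_exp M F (\<lambda>\<omega>. ennreal (b \<omega>) * ?I k \<omega>) \<omega>
      = ennreal (b \<omega>) * ennreal (?p k \<omega>)" if k: "k \<in> I" and b: "b \<in> borel_measurable F" for k b
  proof -
    have "AE \<omega> in M. ennreal (b \<omega>) * nn_cond_exp M F (?I k) \<omega>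
        = nn_cond_exp M F (\<lambda>\<omega>. ennreal (b \<omega>) * ?I k \<omega>) \<omega>"
      using b I_meas[OF k] by (intro nn_cond_exp_prod) measurable
    with nn_cond_exp_indicator[OF E[OF k]] show ?thesis
      by eventually_elim simp
  qed
  have b_meas: "(\<lambda>\<omega>. ennreal (b \<omega>) * ?I k \<omega>) \<in> borel_measurable M"
    if "k \<in> I" "b \<in> borel_measurable F" for k b
    using I_meas[OF that(1)] measurable_from_subalg[OF subalg that(2)] by measurable
  have total: "AE \<omega> in M. nn_cond_exp M F (\<lambda>\<omega>. ennreal (g \<omega>) + (\<Sum>k\<in>I. ennreal (b k \<omega>) * ?I k \<omega>)) \<omega>
      = nn_cond_exp M F (\<lambda>\<omega>. ennreal (g \<omega>)) \<omega> + (\<Sum>k\<in>I. ennreal (b k \<omega>) * ennreal (?p k \<omega>))"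
    if g [measurable]: "g \<in> borel_measurable M" and b: "\<And>k. k \<in> I \<Longrightarrow> b k \<in> borel_measurable F"
    for g b
  proof -
    have "AE \<omega> in M. nn_cond_exp M F (\<lambda>\<omega>. ennreal (g \<omega>)) \<omega>
        + nn_cond_exp M F (\<lambda>\<omega>. \<Sum>k\<in>I. ennreal (b k \<omega>) * ?I k \<omega>) \<omega>
        = nn_cond_exp M F (\<lambda>\<omega>. ennreal (g \<omega>) + (\<Sum>k\<in>I. ennreal (b k \<omega>) * ?I k \<omega>)) \<omega>"
      using b b_meas by (intro nn_cond_exp_sum borel_measurable_sum) auto
    moreover have "AE \<omega> in M. nn_cond_exp M F (\<lambda>\<omega>. \<Sum>k\<in>I. ennreal (b k \<omega>) * ?I k \<omega>) \<omega>
        = (\<Sum>k\<in>I. nn_cond_exp M F (\<lambda>\<omega>. ennreal (b k \<omega>) * ?I k \<omega>) \<omega>)"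
      using b b_meas by (intro nn_cond_exp_finite_sum) auto
    moreover have "AE \<omega> in M. \<forall>k\<in>I. nn_cond_exp M F (\<lambda>\<omega>. ennreal (b k \<omega>) * ?I k \<omega>) \<omega>
        = ennreal (b k \<omega>) * ennreal (?p k \<omega>)"
      using fin b summand by (intro AE_finite_allI) auto
    ultimately show ?thesis
      by eventually_elim simp
  qed
  \<comment> \<open>\<open>ennreal\<close> sends negative reals to 0, so
    \<open>ennreal (a k)\<close> is the positive part of \<open>a k\<close>; applied to
    \<open>c k\<close> and \<open>- c k\<close> it yields both parts of a coefficient.\<close>
  have to_real: "ennreal r + (\<Sum>k\<in>I. ennreal (a k) * ennreal (q k))
      = ennreal (r + (\<Sum>k\<in>I. max 0 (a k) * q k))"
    if "0 \<le> r" "\<And>k. k \<in> I \<Longrightarrow> 0 \<le> q k" for r :: real and a q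
  proof -
    have "ennreal (a k) * ennreal (q k) = ennreal (max 0 (a k) * q k)" if "k \<in> I" for k
      using \<open>\<And>k. k \<in> I \<Longrightarrow> 0 \<le> q k\<close>[OF that] by (auto simp: ennreal_mult' max_def ennreal_neg)
    then show ?thesis
      using that by (simp add: sum_nonneg sum_ennreal flip: ennreal_plus)
  qed
  have split: "(\<Sum>k\<in>I. a k * q k) = (\<Sum>k\<in>I. max 0 (a k) * q k) - (\<Sum>k\<in>I. max 0 (- a k) * q k)"
    for a q :: "_ \<Rightarrow> real"
    unfolding sum_subtractf[symmetric] by (intro sum.cong) (auto simp: max_def)
  have "AE \<omega> in M. ennreal (f \<omega>) + (\<Sum>k\<in>I. ennreal (- c k \<omega>) * ?I k \<omega>)
      \<le> ennreal (V \<omega>) + (\<Sum>k\<in>I. ennreal (c k \<omega>) * ?I k \<omega>)"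
    using le
  proof eventually_elim
    case (elim \<omega>)
    then show ?case
      using split[of "\<lambda>k. c k \<omega>" "\<lambda>k. indicator (E k) \<omega>"] f(2)[of \<omega>] V(2)[of \<omega>]
      by (subst (1 2) to_real) (auto intro!: ennreal_leI)
  qed
  then have "AE \<omega> in M.
      nn_cond_exp M F (\<lambda>\<omega>. ennreal (f \<omega>) + (\<Sum>k\<in>I. ennreal (- c k \<omega>) * ?I k \<omega>)) \<omega>
      \<le> nn_cond_exp M F (\<lambda>\<omega>. ennreal (V \<omega>) + (\<Sum>k\<in>I. ennreal (c k \<omega>) * ?I k \<omega>)) \<omega>"
    using c b_meas by (intro nn_cond_exp_mono borel_measurable_add borel_measurable_sum) auto
  moreover have "AE \<omega> in M.
      nn_cond_exp M F (\<lambda>\<omega>. ennreal (f \<omega>) + (\<Sum>k\<in>I. ennreal (- c k \<omega>) * ?I k \<omega>)) \<omega>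
      = nn_cond_exp M F (\<lambda>\<omega>. ennreal (f \<omega>)) \<omega> + (\<Sum>k\<in>I. ennreal (- c k \<omega>) * ennreal (?p k \<omega>))"
    using c by (intro total) auto
  moreover have "AE \<omega> in M.
      nn_cond_exp M F (\<lambda>\<omega>. ennreal (V \<omega>) + (\<Sum>k\<in>I. ennreal (c k \<omega>) * ?I k \<omega>)) \<omega>
      = nn_cond_exp M F (\<lambda>\<omega>. ennreal (V \<omega>)) \<omega> + (\<Sum>k\<in>I. ennreal (c k \<omega>) * ennreal (?p k \<omega>))"
    using c by (intro total) auto
  moreover have "AE \<omega> in M. ennreal (V \<omega>) = nn_cond_exp M F (\<lambda>\<omega>. ennreal (V \<omega>)) \<omega>"
    by (intro nn_cond_exp_F_meas) measurable
  moreover have "AE \<omega> in M. \<forall>k\<in>I. 0 \<le> ?p k \<omega>"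
    using fin E by (intro AE_finite_allI real_cond_exp_pos) auto
  ultimately show ?thesis
  proof eventually_elim
    case (elim \<omega>)
    let ?n = "\<Sum>k\<in>I. max 0 (- c k \<omega>) * ?p k \<omega>" and ?P = "\<Sum>k\<in>I. max 0 (c k \<omega>) * ?p k \<omega>"
    let ?W = "nn_cond_exp M F (\<lambda>\<omega>. ennreal (f \<omega>)) \<omega>"
    have n: "0 \<le> ?n"
      using elim(5) by (intro sum_nonneg) auto
    have "?W + ennreal ?n \<le> ennreal (V \<omega> + ?P)"
      using elim to_real[of 0 "\<lambda>k. ?p k \<omega>" "\<lambda>k. - c k \<omega>"]
        to_real[of "V \<omega>" "\<lambda>k. ?p k \<omega>" "\<lambda>k. c k \<omega>"] V(2)[of \<omega>] by simp
    then have "?W \<le> ennreal (V \<omega> + ?P) - ennreal ?n"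
      by (simp add: ennreal_le_minus_iff add.commute)
    \<comment> \<open>Truncated subtraction and \<open>ennreal\<close> both turn a negative
      difference into 0, so the two sides agree whatever its sign.\<close>
    also have "\<dots> = ennreal (V \<omega> + ?P - ?n)"
      using n by (simp add: ennreal_minus)
    finally show ?case
      using split[of "\<lambda>k. c k \<omega>" "\<lambda>k. ?p k \<omega>"] by (simp add: add_diff_eq)
  qed
qed

end

section \<open>Actuator law and conditional decrease of the storage\<close>

lemma expectation_actuator:
  assumes "u \<in> {-1..1}"
  shows "measure_pmf.expectation (actuator u) f = (\<Sum>v\<in>{1, 0, -1}. f v * pmf (actuator u) v)"
proof -
  have "set_pmf (actuator u) \<subseteq> {1, 0, -1}"
    using pmf_actuator[OF assms] by (auto simp: set_pmf_iff split: if_splits)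
  then show ?thesis
    by (intro integral_measure_pmf_real) auto
qed

lemma sum_pmf_actuator:
  assumes "u \<in> {-1..1}"
  shows "(\<Sum>v\<in>{1, 0, -1}. pmf (actuator u) v) = 1"
  using expectation_actuator[OF assms, of "\<lambda>_. 1"] by simp

context cyclic_manufacturing_system
begin

lemma state_carrier: "\<omega> \<in> space M \<Longrightarrow> x t \<omega> \<in> carrier_vec (2 * N)"
  using measurable_space[OF state_rv] by simp

lemma actuation_carrier: "\<omega> \<in> space M \<Longrightarrow> u_a t \<omega> \<in> carrier_vec N"
  using measurable_space[OF actuation_rv] by simp

lemma actuation_measurable: "i < N \<Longrightarrow> (\<lambda>\<omega>. u_a t \<omega> $ i) \<in> borel_measurable M"
  using measurable_compose[OF actuation_rv coordinate_measurable] .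

lemma actuation_event: "i < N \<Longrightarrow> {\<omega> \<in> space M. u_a t \<omega> $ i = v} \<in> sets M"
  using actuation_measurable by measurable

lemma sigma_finite_subalgebra_state: "sigma_finite_subalgebra M (generated_by M (2 * N) (x t))"
proof -
  interpret finite_measure_subalgebra M "generated_by M (2 * N) (x t)"
    by unfold_locales (rule subalgebra_generated_by[OF state_rv])
  show ?thesis
    by unfold_locales
qed

text \<open>The conditional probabilities of the three values add up to 1. Integrating them shows
  that the three disjoint events have total probability 1, so any other value occurs only on a null
  set.\<close>

lemma AE_actuation_values:
  assumes i: "i < N" and C: "\<And>y. C i y \<in> {-1..1}"
  shows "AE \<omega> in M. u_a t \<omega> $ i \<in> {1, 0, -1}"
proof -
  interpret F: sigma_finite_subalgebra M "generated_by M (2 * N) (x t)"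
    by (rule sigma_finite_subalgebra_state)
  let ?E = "\<lambda>v. {\<omega> \<in> space M. u_a t \<omega> $ i = v}"
  let ?c = "\<lambda>v. real_cond_exp M (generated_by M (2 * N) (x t)) (indicator (?E v))"
  have int: "integrable M (indicator (?E v) :: _ \<Rightarrow> real)" for v
    using actuation_event[OF i] by (simp add: integrable_indicator_iff emeasure_finite less_top[symmetric])
  have "prob (\<Union>v\<in>{1, 0, -1}. ?E v) = (\<Sum>v\<in>{1, 0, -1}. prob (?E v))"
    using actuation_event[OF i] by (intro finite_measure_finite_Union) (auto simp: disjoint_family_on_def)
  also have "\<dots> = (\<Sum>v\<in>{1, 0, -1}. \<integral>\<omega>. ?c v \<omega> \<partial>M)"
    using actuation_event[OF i] F.real_cond_exp_int(2)[OF int] by (simp add: sets.Int_space_eq2)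
  also have "\<dots> = (\<integral>\<omega>. (\<Sum>v\<in>{1, 0, -1}. ?c v \<omega>) \<partial>M)"
    using F.real_cond_exp_int(1)[OF int] by (intro Bochner_Integration.integral_sum[symmetric]) auto
  also have "\<dots> = (\<integral>\<omega>. 1 \<partial>M)"
  proof (rule integral_cong_AE)
    have "AE \<omega> in M. \<forall>v\<in>{1, 0, -1}. ?c v \<omega> = pmf (actuator (C i (controller_input N (x t \<omega>) $ i))) v"
      using actuation_law[OF i] by (intro AE_finite_allI) auto
    then show "AE \<omega> in M. (\<Sum>v\<in>{1, 0, -1}. ?c v \<omega>) = 1"
    proof eventually_elim
      case (elim \<omega>)
      then have "(\<Sum>v\<in>{1, 0, -1}. ?c v \<omega>)
          = (\<Sum>v\<in>{1, 0, -1}. pmf (actuator (C i (controller_input N (x t \<omega>) $ i))) v)"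
        by (intro sum.cong) auto
      then show ?case
        using sum_pmf_actuator[OF C] by simp
    qed
  qed auto
  finally have "prob (\<Union>v\<in>{1, 0, -1}. ?E v) = 1"
    by (simp add: prob_space)
  then have "AE \<omega> in M. \<omega> \<in> (\<Union>v\<in>{1, 0, -1}. ?E v)"
    using actuation_event[OF i] by (subst (asm) prob_eq_1) auto
  then show ?thesis
    by eventually_elim auto
qed

lemma cond_exp_storage_le:
  assumes h: "0 < h" "h < 1"
    and C: "\<And>i y. i < N \<Longrightarrow> C i y \<in> {-1..1}"
    and \<delta>: "2 * gamma_m h \<le> \<delta>"
    and dissipative: "\<And>i y. i < N \<Longrightarrow>
      \<delta> * measure_pmf.expectation (actuator (C i y)) (\<lambda>u. u\<^sup>2)
        \<le> measure_pmf.expectation (actuator (C i y)) (\<lambda>u. u * y)"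
  shows "AE \<omega> in M. nn_cond_exp M (generated_by M (2 * N) (x t))
      (\<lambda>\<omega>. ennreal (storage (x (t + 1) \<omega>))) \<omega> \<le> ennreal (storage (x t \<omega>))"
proof -
  let ?F = "generated_by M (2 * N) (x t)"
  interpret F: sigma_finite_subalgebra M ?F
    by (rule sigma_finite_subalgebra_state)
  define y where "y i \<omega> = controller_input N (x t \<omega>) $ i" for i \<omega>
  \<comment> \<open>The bound for route \<open>i\<close> is expanded over the possible values
    \<open>v\<close> of its actuator: \<open>c (i, v)\<close> depends on the current state only, and
    the indicator of \<open>E (i, v)\<close> carries the randomness of the actuation.\<close>
  define E where "E = (\<lambda>(i, v). {\<omega> \<in> space M. u_a t \<omega> $ i = v})"
  define c where "c = (\<lambda>(i, v) \<omega>. \<delta> * v\<^sup>2 - v * y i \<omega>)"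
  let ?I = "{..<N} \<times> {1, 0, -1 :: real}"
  have xF: "x t \<in> ?F \<rightarrow>\<^sub>M vec_borel (2 * N)"
    by (rule measurable_generated_by[OF state_rv])
  have space: "space ?F = space M"
    by (simp add: generated_by_def)
  have y_meas: "y i \<in> borel_measurable ?F" if i: "i < N" for i
  proof -
    have s: "2 * i + 1 < 2 * N" "2 * ((i + 1) mod N) < 2 * N"
      using i by auto
    have "(\<lambda>\<omega>. x t \<omega> $ (2 * i + 1) - x t \<omega> $ (2 * ((i + 1) mod N))) \<in> borel_measurable ?F"
      using s by (intro borel_measurable_diff measurable_compose[OF xF coordinate_measurable])
    then show ?thesis
      by (rule measurable_cong[THEN iffD1, rotated])
        (use i in \<open>simp add: y_def space index_controller_input[OF state_carrier]\<close>)
  qed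
  have "AE \<omega> in M. \<forall>i\<in>{..<N}. u_a t \<omega> $ i \<in> {1, 0, -1}"
    using C by (intro AE_finite_allI AE_actuation_values) auto
  then have step: "AE \<omega> in M. storage (x (t + 1) \<omega>)
      \<le> storage (x t \<omega>) + (\<Sum>k\<in>?I. c k \<omega> * indicator (E k) \<omega>)"
    using AE_space
  proof eventually_elim
    case (elim \<omega>)
    have "(\<Sum>k\<in>?I. c k \<omega> * indicator (E k) \<omega>)
        = (\<Sum>i<N. \<Sum>v\<in>{1, 0, -1}. c (i, v) \<omega> * indicator (E (i, v)) \<omega>)"
      by (rule sum.cartesian_product')
    \<comment> \<open>Exactly one of the three indicators of a route equals 1 here.\<close>
    also have "\<dots> = (\<Sum>i<N. \<delta> * (u_a t \<omega> $ i)\<^sup>2 - u_a t \<omega> $ i * y i \<omega>)"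
      using elim by (intro sum.cong) (auto simp: c_def E_def indicator_def)
    finally show ?case
      using storage_step_le[OF h state_carrier[OF elim(2)] actuation_carrier[OF elim(2)] \<delta>, of t t]
      by (simp add: y_def dynamics[OF elim(2), simplified])
  qed
  have "AE \<omega> in M. nn_cond_exp M ?F (\<lambda>\<omega>. ennreal (storage (x (t + 1) \<omega>))) \<omega>
      \<le> ennreal (storage (x t \<omega>) + (\<Sum>k\<in>?I. c k \<omega> * real_cond_exp M ?F (indicator (E k)) \<omega>))"
  proof (rule F.nn_cond_exp_le_indicator_sum[OF _ _ _ _ _ _ _ step])
    show "E k \<in> sets M" if "k \<in> ?I" for k
      using that actuation_event by (auto simp: E_def)
    show "c k \<in> borel_measurable ?F" if "k \<in> ?I" for k
      using that y_meas by (auto simp: c_def)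
    show "(\<lambda>\<omega>. storage (x (t + 1) \<omega>)) \<in> borel_measurable M"
      by (rule measurable_compose[OF state_rv storage_measurable])
    show "(\<lambda>\<omega>. storage (x t \<omega>)) \<in> borel_measurable ?F"
      by (rule measurable_compose[OF xF storage_measurable])
  qed (simp_all add: storage_nonneg)
  moreover have "AE \<omega> in M. \<forall>k\<in>?I. real_cond_exp M ?F (indicator (E k)) \<omega>
      = pmf (actuator (C (fst k) (y (fst k) \<omega>))) (snd k)"
    using actuation_law by (intro AE_finite_allI) (auto simp: E_def y_def)
  ultimately show ?thesis
  proof eventually_elim
    case (elim \<omega>)
    have "(\<Sum>k\<in>?I. c k \<omega> * real_cond_exp M ?F (indicator (E k)) \<omega>)
        = (\<Sum>k\<in>?I. c k \<omega> * pmf (actuator (C (fst k) (y (fst k) \<omega>))) (snd k))"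
      using elim(2) by (intro sum.cong) auto
    also have "\<dots> = (\<Sum>i<N. \<Sum>v\<in>{1, 0, -1}. (\<delta> * v\<^sup>2 - v * y i \<omega>) * pmf (actuator (C i (y i \<omega>))) v)"
      by (simp only: sum.cartesian_product' c_def prod.case fst_conv snd_conv)
    \<comment> \<open>For each route the inner sum is \<delta> times the second moment of the
      actuator output minus the mean of its product with \<open>y i \<omega>\<close>; the cascade
      hypothesis at this input makes it nonpositive.\<close>
    also have "\<dots> \<le> 0"
    proof (rule sum_nonpos)
      fix i assume "i \<in> {..<N}"
      then show "(\<Sum>v\<in>{1, 0, -1}. (\<delta> * v\<^sup>2 - v * y i \<omega>) * pmf (actuator (C i (y i \<omega>))) v) \<le> 0"
        using dissipative[of i "y i \<omega>"] expectation_actuator[OF C[of i "y i \<omega>"]]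
        by (simp add: algebra_simps)
    qed
    finally show ?case
      by (intro order_trans[OF elim(1)] ennreal_leI) simp
  qed
qed

end

theorem proposition6:
  fixes M :: "'w measure" and N :: nat and h \<delta> :: real
    and C :: "nat \<Rightarrow> real \<Rightarrow> real"
    and x u_a :: "nat \<Rightarrow> 'w \<Rightarrow> real vec"
  assumes "N \<ge> 1"
    and "0 < h" and "h < 1"
    and "cyclic_manufacturing_system M N h C x u_a"
    and "\<And>i y. i < N \<Longrightarrow> C i y \<in> {-1..1}"
    and "\<delta> \<ge> 2 * gamma_m h"
    and "\<And>i y. i < N \<Longrightarrow>
      measure_pmf.expectation (actuator (C i y)) (\<lambda>u. u * y)
        \<ge> \<delta> * measure_pmf.expectation (actuator (C i y)) (\<lambda>u. u\<^sup>2)"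
  shows "\<forall>t. AE \<omega> in M.
    enn2ereal (nn_cond_exp M (generated_by M (2 * N) (x t))
                 (\<lambda>\<omega>. ennreal (storage (x (t + 1) \<omega>))) \<omega>)
      - ereal (storage (x t \<omega>)) \<le> 0"
proof
  fix t
  interpret cyclic_manufacturing_system M N h C x u_a
    by (rule assms(4))
  have "AE \<omega> in M. nn_cond_exp M (generated_by M (2 * N) (x t))
      (\<lambda>\<omega>. ennreal (storage (x (t + 1) \<omega>))) \<omega> \<le> ennreal (storage (x t \<omega>))"
    using assms by (intro cond_exp_storage_le) auto
  \<comment> \<open>The difference is formed in \<open>ereal\<close>, where subtraction is not
    truncated at 0. The storage is a finite nonnegative real, so it survives the conversion from
    \<open>ennreal\<close> unchanged and can be moved across the inequality.\<close>
  then show "AE \<omega> in M. enn2ereal (nn_cond_exp M (generated_by M (2 * N) (x t))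
      (\<lambda>\<omega>. ennreal (storage (x (t + 1) \<omega>))) \<omega>) - ereal (storage (x t \<omega>)) \<le> 0"
  proof eventually_elim
    case (elim \<omega>)
    then have "enn2ereal (nn_cond_exp M (generated_by M (2 * N) (x t))
        (\<lambda>\<omega>. ennreal (storage (x (t + 1) \<omega>))) \<omega>) \<le> ereal (storage (x t \<omega>))"
      by (simp add: less_eq_ennreal.rep_eq enn2ereal_ennreal storage_nonneg)
    then show ?case
      by (simp add: ereal_minus_le_iff)
  qed
qed

end
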